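(* Let $N\geq 2$ and $s\geq 1$. Two 3-regular $(N+1)$-linear forms $w$ and $w'$ on $\mathbb K^{s+1}$ correspond to isomorphic graded algebras $\mathcal A(w,N)$ and $\mathcal A(w',N)$ if and only if they belong to the same $GL(s+1,\mathbb K)$-orbit, i.e. if and only if $w'=w\circ L$ for some $L\in GL(s+1,\mathbb K)$.
   Context: $\mathbb K$ is an algebraically closed field of characteristic zero. For $L\in GL(s+1,\mathbb K)$ and an $m$-linear form $w$, $(w\circ L)(X_1,\dots,X_m)=w(LX_1,\dots,LX_m)$. Preregular: an $m$-linear form $w$ on a vector space $V$ ($\dim V\geq 2$, $m\geq 2$) is preregular if (i) $w(X,X_1,\dots,X_{m-1})=0$ for all $X_1,\dots,X_{m-1}\in V$ implies $X=0$, and (ii) there is $Q_w\in GL(V)$ with $w(X_1,\dots,X_m)=w(Q_wX_m,X_1,\dots,X_{m-1})$ for all $X_i\in V$. 3-regular: an $(N+1)$-linear form $w$ on $V$ is 3-regular if it is preregular and (iii) whenever endomorphisms $L_0,L_1$ of $V$ satisfy $w(L_0X_0,X_1,X_2,\dots,X_N)=w(X_0,L_1X_1,X_2,\dots,X_N)$ for all $X_0,\dots,X_N\in V$, then $L_0=L_1=\lambda\,\mathrm{Id}$ for some $\lambda\in\mathbb K$. $\mathcal A(w,N)$: with components $W_{\lambda_0\dots\lambda_N}=w(e_{\lambda_0},\dots,e_{\lambda_N})$ in the canonical basis of $\mathbb K^{s+1}$, $\mathcal A(w,N)$ is the graded unital associative algebra generated by $x^0,\dots,x^s$ in degree 1 with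 the relations $\sum_{\lambda_1,\dots,\lambda_N}W_{\lambda\lambda_1\dots\lambda_N}x^{\lambda_1}\cdots x^{\lambda_N}=0$ for $\lambda\in\{0,\dots,s\}$. *)

theory Defs
  imports
    "HOL-Analysis.Cartesian_Space"
    "HOL-Library.Poly_Mapping"
    "HOL-Algebra.QuotRing"
    "HOL-Algebra.Module"
    "HOL-Algebra.Algebraic_Closure_Type"
begin

section \<open>Multilinear forms on a coordinate space\<close>

text \<open>
  An \<open>m\<close>-linear form on \<open>'k ^ 'n\<close> is a function on lists of vectors of which only the values
  on lists of length \<open>m\<close> matter: two such functions represent the same form iff they agree on
  all lists of length \<open>m\<close>.
\<close>

definition multilinear_form :: "nat \<Rightarrow> (('k::field ^ 'n) list \<Rightarrow> 'k) \<Rightarrow> bool"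
  where "multilinear_form m w \<longleftrightarrow>
    (\<forall>xs. length xs = m \<longrightarrow>
      (\<forall>i<m. Vector_Spaces.linear (*s) (*) (\<lambda>x. w (xs[i := x]))))"

definition preregular :: "nat \<Rightarrow> (('k::field ^ 'n) list \<Rightarrow> 'k) \<Rightarrow> bool"
  where "preregular m w \<longleftrightarrow>
    2 \<le> m \<and> 2 \<le> CARD('n) \<and> multilinear_form m w \<and>
    (\<forall>x. (\<forall>xs. length xs = m - 1 \<longrightarrow> w (x # xs) = 0) \<longrightarrow> x = 0) \<and>
    (\<exists>Q. Vector_Spaces.linear (*s) (*s) Q \<and> bij Q \<and>
      (\<forall>xs x. length xs = m - 1 \<longrightarrow> w (xs @ [x]) = w (Q x # xs)))"

definition three_regular :: "nat \<Rightarrow> (('k::field ^ 'n) list \<Rightarrow> 'k) \<Rightarrow> bool"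
  where "three_regular N w \<longleftrightarrow>
    preregular (N + 1) w \<and>
    (\<forall>L0 L1. Vector_Spaces.linear (*s) (*s) L0 \<and> Vector_Spaces.linear (*s) (*s) L1 \<and>
      (\<forall>x0 x1 xs. length xs = N - 1 \<longrightarrow> w (L0 x0 # x1 # xs) = w (x0 # L1 x1 # xs))
      \<longrightarrow> (\<exists>c. L0 = (\<lambda>x. c *s x) \<and> L1 = (\<lambda>x. c *s x)))"

definition form_comp :: "(('k::field ^ 'n) list \<Rightarrow> 'k) \<Rightarrow> 'k ^ 'n ^ 'n \<Rightarrow> ('k ^ 'n) list \<Rightarrow> 'k"
  where "form_comp w L xs = w (map ((*v) L) xs)"


section \<open>Free algebras\<close>

text \<open>
  Words under concatenation, written additively so that \<open>'n free_mon \<Rightarrow>\<^sub>0 'k\<close>, with the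
  convolution product of \<^theory>\<open>HOL-Library.Poly_Mapping\<close>, is the free associative algebra
  \<open>'k\<langle>x\<^sub>i | i \<in> 'n\<rangle>\<close>. The wrapper type avoids a global \<open>monoid_add\<close> instance for lists.
\<close>

datatype 'n free_mon = Word (letters: "'n list")

instantiation free_mon :: (type) monoid_add
begin

definition zero_free_mon :: "'a free_mon"
  where "0 = Word []"

definition plus_free_mon :: "'a free_mon \<Rightarrow> 'a free_mon \<Rightarrow> 'a free_mon"
  where "u + v = Word (letters u @ letters v)"

instance
  by standard (simp_all add: zero_free_mon_def plus_free_mon_def)

end

type_synonym ('k, 'n) free_alg = "'n free_mon \<Rightarrow>\<^sub>0 'k"

definition const :: "'k::field \<Rightarrow> ('k, 'n) free_alg"
  where "const c = Poly_Mapping.single 0 c"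

definition gen :: "'n \<Rightarrow> ('k::field, 'n) free_alg"
  where "gen i = Poly_Mapping.single (Word [i]) 1"

definition homogeneous :: "nat \<Rightarrow> ('k::field, 'n) free_alg set"
  where "homogeneous d = {p. \<forall>u \<in> Poly_Mapping.keys p. length (letters u) = d}"


section \<open>Graded algebras\<close>

record ('k, 'a) graded_algebra = "('k, 'a) module" +
  component :: "nat \<Rightarrow> 'a set"

definition isomorphic_graded_algebras ::
    "('k, 'a) graded_algebra \<Rightarrow> ('k, 'b) graded_algebra \<Rightarrow> bool"
  where "isomorphic_graded_algebras A B \<longleftrightarrow>
    (\<exists>f \<in> ring_iso A B.
      (\<forall>c. \<forall>x \<in> carrier A. f (c \<odot>\<^bsub>A\<^esub> x) = c \<odot>\<^bsub>B\<^esub> f x) \<and>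
      (\<forall>d. f ` component A d = component B d))"

text \<open>
  The quotient of the free algebra by the two-sided ideal generated by \<open>R\<close>, graded by the
  images of the homogeneous components; this is a grading when \<open>R\<close> consists of homogeneous
  elements. A scalar acts as multiplication by its image in the quotient.
\<close>

definition presented_algebra ::
    "('k::field, 'n) free_alg set \<Rightarrow> ('k, ('k, 'n) free_alg set) graded_algebra"
  where "presented_algebra R =
    (let F = ring_of_type_algebra; I = genideal F R; A = F Quot I in
      \<lparr>carrier = carrier A, monoid.mult = monoid.mult A, one = one A,
       ring.zero = ring.zero A, add = add A,
       module.smult = (\<lambda>c x. (I +>\<^bsub>F\<^esub> const c) \<otimes>\<^bsub>A\<^esub> x),
       component = (\<lambda>d. (\<lambda>p. I +>\<^bsub>F\<^esub> p) ` homogeneous d)\<rparr>)"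


section \<open>The algebra of a multilinear form\<close>

definition form_coeff :: "(('k::field ^ 'n) list \<Rightarrow> 'k) \<Rightarrow> 'n list \<Rightarrow> 'k"
  where "form_coeff w js = w (map (\<lambda>i. axis i 1) js)"

definition form_relation ::
    "(('k::field ^ 'n) list \<Rightarrow> 'k) \<Rightarrow> nat \<Rightarrow> 'n \<Rightarrow> ('k, 'n) free_alg"
  where "form_relation w N i =
    (\<Sum>js | length js = N. const (form_coeff w (i # js)) * prod_list (map gen js))"

definition form_algebra ::
    "(('k::field ^ 'n) list \<Rightarrow> 'k) \<Rightarrow> nat \<Rightarrow> ('k, ('k, 'n) free_alg set) graded_algebra"
  where "form_algebra w N = presented_algebra (range (form_relation w N))"

end

theory Submission
  imports Defs
begin

text \<open>
  A graded isomorphism \<open>\<A>(w, N) \<cong> \<A>(w', N)\<close> is induced by a linear substitution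
  \<open>x\<^sub>i \<mapsto> \<Sum>\<^sub>j L\<^sub>i\<^sub>j x\<^sub>j\<close> of the generators, and in degree \<open>N\<close> the ideal of relations is just the span of
  the defining relations. Hence the substitution carries the span of the relations of \<open>w\<close> into
  that of \<open>w'\<close>, which says \<open>w(LX\<^sub>0, \<dots>, LX\<^sub>N) = w'(PX\<^sub>0, X\<^sub>1, \<dots>, X\<^sub>N)\<close> for some endomorphism \<open>P\<close>. Using
  the twisted cyclicity of both forms, \<open>P\<close> can be moved from the first to the second argument
  of \<open>w'\<close> at the cost of replacing it by another endomorphism, so 3-regularity of \<open>w'\<close> makes
  \<open>P\<close> a scalar \<open>c\<close>; it is non-zero since \<open>w\<close> is non-degenerate, and rescaling \<open>L\<close> by an
  \<open>(N + 1)\<close>-st root of \<open>1 / c\<close> gives \<open>w' = w \<circ> L\<close>.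
\<close>

unbundle no fps_syntax

section \<open>Multilinear forms\<close>

lemma sum_lists_Suc:
  fixes g :: "'n::finite list \<Rightarrow> 'a::comm_monoid_add"
  shows "(\<Sum>is | length is = Suc m. g is) = (\<Sum>i\<in>UNIV. \<Sum>is | length is = m. g (i # is))"
proof -
  have "(\<Sum>is | length is = Suc m. g is) = (\<Sum>(i, is)\<in>UNIV \<times> {is. length is = m}. g (i # is))"
    by (rule sum.reindex_bij_witness[of _ "\<lambda>(i, is). i # is" "\<lambda>is. (hd is, tl is)"])
      (auto simp: length_Suc_conv)
  then show ?thesis
    by (simp add: sum.cartesian_product)
qed

lemma finite_lists_of_length [simp]: "finite {is :: 'n::finite list. length is = m}"
  using finite_lists_length_eq[of "UNIV :: 'n set" m] by simp

lemma multilinear_form_Cons: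
  assumes "multilinear_form (Suc m) w"
  shows "multilinear_form m (\<lambda>xs. w (x # xs))"
  unfolding multilinear_form_def
proof (intro allI impI)
  fix xs :: "('a ^ 'b) list" and i
  assume "length xs = m" "i < m"
  then have "Vector_Spaces.linear (*s) (*) (\<lambda>y. w ((x # xs)[Suc i := y]))"
    using assms unfolding multilinear_form_def by (metis Suc_less_eq length_Cons)
  then show "Vector_Spaces.linear (*s) (*) (\<lambda>y. w (x # xs[i := y]))"
    by simp
qed

lemma multilinear_form_linear_hd:
  assumes "multilinear_form (Suc m) w" "length xs = m"
  shows "Vector_Spaces.linear (*s) (*) (\<lambda>x. w (x # xs))"
proof -
  have "Vector_Spaces.linear (*s) (*) (\<lambda>y. w ((0 # xs)[0 := y]))"
    using assms unfolding multilinear_form_def by (metis length_Cons zero_less_Suc)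
  then show ?thesis by simp
qed

lemma linear_functional_expansion:
  assumes "Vector_Spaces.linear (*s) (*) (f :: 'k::field ^ 'n \<Rightarrow> 'k)"
  shows "f x = (\<Sum>i\<in>UNIV. x $ i * f (axis i 1))"
proof -
  interpret f: Vector_Spaces.linear "(*s)" "(*)" f by fact
  have "f x = f (\<Sum>i\<in>UNIV. x $ i *s axis i 1)"
    by (simp add: basis_expansion)
  then show ?thesis
    by (simp add: f.sum f.scale)
qed

text \<open>Induction on the number of arguments: the head is expanded in the canonical basis, and
  the hypothesis applies to the form whose head is frozen at a basis vector.\<close>

lemma multilinear_form_expansion:
  fixes w :: "('k::field ^ 'n) list \<Rightarrow> 'k"
  assumes "multilinear_form m w" "length xs = m"
  shows "w xs = (\<Sum>is | length is = m. prod_list (map2 ($) xs is) * form_coeff w is)"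
  using assms
proof (induction m arbitrary: w xs)
  case 0
  then show ?case by (simp add: form_coeff_def)
next
  case (Suc m)
  then obtain x ys where xs: "xs = x # ys" and len: "length ys = m"
    by (auto simp: length_Suc_conv)
  have "w xs = (\<Sum>i\<in>UNIV. x $ i * w (axis i 1 # ys))"
    unfolding xs
    by (rule linear_functional_expansion[OF multilinear_form_linear_hd[OF Suc.prems(1) len]])
  also have "\<dots> = (\<Sum>i\<in>UNIV. x $ i *
      (\<Sum>is | length is = m. prod_list (map2 ($) ys is) * form_coeff w (i # is)))"
    using Suc.IH[OF multilinear_form_Cons[OF Suc.prems(1)] len]
    by (simp add: form_coeff_def)
  finally show ?case
    by (simp add: sum_lists_Suc xs sum_distrib_left mult.assoc)
qed

lemma multilinear_form_eqI:
  assumes "multilinear_form m w" "multilinear_form m w'" "length xs = m"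
    and "\<And>is. length is = m \<Longrightarrow> form_coeff w is = form_coeff w' is"
  shows "w xs = w' xs"
  by (simp add: multilinear_form_expansion[OF assms(1,3)] multilinear_form_expansion[OF assms(2,3)]
      assms(4))

lemma multilinear_form_form_comp:
  assumes "multilinear_form m w"
  shows "multilinear_form m (form_comp w L)"
  unfolding multilinear_form_def
proof (intro allI impI)
  fix xs :: "('a ^ 'b) list" and i
  assume "length xs = m" "i < m"
  then have "Vector_Spaces.linear (*s) (*) (\<lambda>x. w ((map ((*v) L) xs)[i := x]))"
    using assms by (simp add: multilinear_form_def)
  from Vector_Spaces.linear_compose[OF matrix_vector_mul_linear_gen this]
  show "Vector_Spaces.linear (*s) (*) (\<lambda>x. form_comp w L (xs[i := x]))"
    by (simp add: form_comp_def map_update comp_def)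
qed

lemma multilinear_form_scale:
  assumes "multilinear_form m w" "length xs = m"
  shows "w (map ((*s) c) xs) = c ^ m * w xs"
  using assms
proof (induction m arbitrary: w xs)
  case 0
  then show ?case by simp
next
  case (Suc m)
  then obtain x ys where xs: "xs = x # ys" and len: "length ys = m"
    by (auto simp: length_Suc_conv)
  have "w (c *s x # map ((*s) c) ys) = c * w (x # map ((*s) c) ys)"
    using multilinear_form_linear_hd[OF Suc.prems(1), of "map ((*s) c) ys"] len
    by (simp add: Vector_Spaces.linear_iff)
  then show ?case
    using Suc.IH[OF multilinear_form_Cons[OF Suc.prems(1)] len] by (simp add: xs)
qed

section \<open>Free algebras and linear substitutions\<close>

lemma letters_zero [simp]: "letters 0 = []"
  by (simp add: zero_free_mon_def)

lemma letters_plus [simp]: "letters (u + v) = letters u @ letters v"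
  by (simp add: plus_free_mon_def)

lemma const_add: "const (a + b) = const a + const b"
  by (simp add: const_def single_add)

lemma const_mult: "const (a * b) = const a * const b"
  by (simp add: const_def mult_single)

lemma const_0 [simp]: "const 0 = 0" and const_1 [simp]: "const 1 = 1"
  by (simp_all add: const_def)

lemma const_sum: "const (sum f A) = (\<Sum>a\<in>A. const (f a))"
  by (induction A rule: infinite_finite_induct) (simp_all add: const_add)

lemma prod_list_gen: "prod_list (map gen is) = Poly_Mapping.single (Word is) 1"
  by (induction "is")
    (simp_all add: gen_def mult_single plus_free_mon_def flip: zero_free_mon_def)

lemma single_eq_const_gen:
  "Poly_Mapping.single u c = const c * prod_list (map gen (letters u))"
  by (simp add: const_def prod_list_gen mult_single)

lemma poly_mapping_sum_singles:
  fixes p :: "'a \<Rightarrow>\<^sub>0 'b::comm_monoid_add"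
  shows
  "p = (\<Sum>u\<in>Poly_Mapping.keys p. Poly_Mapping.single u (Poly_Mapping.lookup p u))"
  by (rule poly_mapping_eqI)
    (auto simp: lookup_sum lookup_single when_def in_keys_iff)

lemma poly_mapping_add_induct [case_names single add]:
  fixes p :: "'a \<Rightarrow>\<^sub>0 'b::comm_monoid_add"
  assumes "\<And>u c. P (Poly_Mapping.single u c)" "\<And>p q. P p \<Longrightarrow> P q \<Longrightarrow> P (p + q)"
  shows "P p"
proof -
  have "P 0"
    using assms(1)[of undefined 0] by simp
  then have "P (\<Sum>u\<in>A. Poly_Mapping.single u (Poly_Mapping.lookup p u))" for A
    by (induction A rule: infinite_finite_induct) (auto intro: assms)
  then show ?thesis
    by (metis poly_mapping_sum_singles)
qed

text \<open>Constants and generators generate the free algebra as a ring. Agreement of two ring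
  homomorphisms therefore needs checking only there, which is how the lemma is used below.\<close>

lemma free_alg_induct [case_names const gen add mult]:
  assumes "\<And>c. P (const c)" "\<And>i. P (gen i)"
    and "\<And>p q. P p \<Longrightarrow> P q \<Longrightarrow> P (p + q)" "\<And>p q. P p \<Longrightarrow> P q \<Longrightarrow> P (p * q)"
  shows "P p"
proof (induction p rule: poly_mapping_add_induct)
  case (single u c)
  have "P (prod_list (map gen is))" for "is"
    by (induction "is") (use assms(1)[of 1] in \<open>auto intro: assms\<close>)
  then show ?case
    by (simp add: single_eq_const_gen assms)
qed (rule assms)

lemma const_mult_commute: "const c * p = p * const c"
  by (induction p rule: poly_mapping_add_induct)
    (simp_all add: const_def mult_single mult.commute algebra_simps)

lemma lookup_single_mult:
  "Poly_Mapping.lookup (Poly_Mapping.single (Word v) c * p) (Word (v @ u)) =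
    c * Poly_Mapping.lookup p (Word u)"
proof -
  have *: "Word (v @ u) = Word v + q \<longleftrightarrow> q = Word u" for q
    by (cases q) (auto simp: plus_free_mon_def)
  show ?thesis
    by (simp add: lookup_mult lookup_single when_mult *)
qed

lemma lookup_const_mult: "Poly_Mapping.lookup (const c * p) u = c * Poly_Mapping.lookup p u"
  using lookup_single_mult[of "[]" c p "letters u"] by (simp add: const_def zero_free_mon_def)

lemma lookup_gen_mult:
  "Poly_Mapping.lookup (gen i * p) (Word (j # u)) =
    (if i = j then Poly_Mapping.lookup p (Word u) else 0)"
  "Poly_Mapping.lookup (gen i * p) (Word []) = 0"
proof -
  have *: "Word (j # u) = Word [i] + q \<longleftrightarrow> i = j \<and> q = Word u" for q
    by (cases q) (auto simp: plus_free_mon_def)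
  show "Poly_Mapping.lookup (gen i * p) (Word (j # u)) =
    (if i = j then Poly_Mapping.lookup p (Word u) else 0)"
    by (simp add: lookup_mult lookup_single when_mult gen_def *)
  have *: "Word [] \<noteq> Word [i] + q" for q
    by (cases q) (auto simp: plus_free_mon_def)
  show "Poly_Mapping.lookup (gen i * p) (Word []) = 0"
    by (simp add: lookup_mult lookup_single when_mult gen_def *)
qed

text \<open>In a factorisation of \<open>u\<close> that contributes to the coefficient, the part
  taken from \<open>p\<close> cannot be shorter than \<open>u\<close>. So it is all of
  \<open>u\<close>, and \<open>a\<close> contributes only its constant term.\<close>

lemma lookup_mult_low:
  assumes "\<And>v. length (letters v) < length (letters u) \<Longrightarrow> Poly_Mapping.lookup p v = 0"
  shows "Poly_Mapping.lookup (a * p) u = Poly_Mapping.lookup a 0 * Poly_Mapping.lookup p u"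
    and "Poly_Mapping.lookup (p * a) u = Poly_Mapping.lookup p u * Poly_Mapping.lookup a 0"
proof -
  have split_low: "u = l + q \<longleftrightarrow> l = 0 \<and> q = u"
    if "\<not> length (letters q) < length (letters u)" for q l
    using that by (cases u; cases l; cases q) (auto simp: plus_free_mon_def zero_free_mon_def)
  have "(Poly_Mapping.lookup p q when u = l + q) =
      (if q = u then Poly_Mapping.lookup p u when l = 0 else 0)" for q l
    using assms[of q] split_low[of q l]
    by (cases "length (letters q) < length (letters u)") (auto simp: when_def)
  then show "Poly_Mapping.lookup (a * p) u = Poly_Mapping.lookup a 0 * Poly_Mapping.lookup p u"
    by (simp add: lookup_mult mult_when)
  have split_low: "u = l + q \<longleftrightarrow> q = 0 \<and> l = u"
    if "\<not> length (letters l) < length (letters u)" for q l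
    using that by (cases u; cases l; cases q) (auto simp: plus_free_mon_def zero_free_mon_def)
  \<comment> \<open>With \<open>p\<close> as left factor, its low coefficients are indexed by the
    outer sum of the convolution, so here whole outer terms collapse.\<close>
  have "Poly_Mapping.lookup p l * (\<Sum>q. Poly_Mapping.lookup a q when u = l + q) =
      (if l = u then Poly_Mapping.lookup p u * Poly_Mapping.lookup a 0 else 0)" for l
    using assms[of l] split_low[of l]
    by (cases "length (letters l) < length (letters u)") (auto simp: when_def)
  then show "Poly_Mapping.lookup (p * a) u = Poly_Mapping.lookup p u * Poly_Mapping.lookup a 0"
    by (simp add: lookup_mult)
qed

section \<open>Linear substitutions of the generators\<close>

definition linear_subst :: "'k::field ^ 'n ^ 'n \<Rightarrow> 'n \<Rightarrow> ('k, 'n) free_alg" where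
  "linear_subst M i = (\<Sum>j\<in>UNIV. const (M $ i $ j) * gen j)"

text \<open>The unital algebra endomorphism given by the universal property of the free algebra,
  written out on words.\<close>

definition subst :: "'k::field ^ 'n ^ 'n \<Rightarrow> ('k, 'n) free_alg \<Rightarrow> ('k, 'n) free_alg" where
  "subst M p = (\<Sum>u\<in>Poly_Mapping.keys p.
    const (Poly_Mapping.lookup p u) * prod_list (map (linear_subst M) (letters u)))"

lemma subst_add: "subst M (p + q) = subst M p + subst M q"
  unfolding subst_def by (rule setsum_keys_plus_distrib) (simp_all add: const_add algebra_simps)

lemma subst_single:
  "subst M (Poly_Mapping.single u c) = const c * prod_list (map (linear_subst M) (letters u))"
  by (simp add: subst_def)

lemma subst_0 [simp]: "subst M 0 = 0"
  by (simp add: subst_def)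

lemma subst_const [simp]: "subst M (const c) = const c"
  using subst_single[of M 0 c] by (simp add: const_def)

lemma subst_gen [simp]: "subst M (gen i) = linear_subst M i"
  by (simp add: gen_def subst_single)

lemma subst_mult: "subst M (p * q) = subst M p * subst M q"
proof (induction p rule: poly_mapping_add_induct)
  case (single u c)
  show ?case
  proof (induction q rule: poly_mapping_add_induct)
    case (single v d)
    then show ?case
      by (simp add: mult_single subst_single const_mult mult.assoc)
        (metis const_mult_commute mult.assoc)
  qed (simp add: subst_add algebra_simps)
qed (simp add: subst_add algebra_simps)

lemma subst_sum: "subst M (sum f A) = (\<Sum>a\<in>A. subst M (f a))"
  by (induction A rule: infinite_finite_induct) (simp_all add: subst_add)

text \<open>Row \<open>i\<close> of the matrix holds the image of \<open>gen i\<close>, so the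
  substitution performed first stands on the left of the matrix product. It suffices to compare the
  two homomorphisms on generators.\<close>

lemma subst_subst: "subst M (subst M' p) = subst (M' ** M) p"
proof (induction p rule: free_alg_induct)
  case (gen i)
  have "subst M (subst M' (gen i)) =
      (\<Sum>j\<in>UNIV. \<Sum>k\<in>UNIV. const (M' $ i $ j * M $ j $ k) * gen k)"
    by (simp add: linear_subst_def subst_sum subst_mult sum_distrib_left const_mult mult.assoc)
  also have "\<dots> = (\<Sum>k\<in>UNIV. \<Sum>j\<in>UNIV. const (M' $ i $ j * M $ j $ k) * gen k)"
    by (rule sum.swap)
  also have "\<dots> = subst (M' ** M) (gen i)"
    by (simp add: linear_subst_def matrix_matrix_mult_def const_sum sum_distrib_right)
  finally show ?case .
qed (simp_all add: subst_add subst_mult)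

lemma subst_mat_1 [simp]:
  fixes p :: "('k::field, 'n::finite) free_alg"
  shows "subst (mat 1) p = p"
proof (induction p rule: free_alg_induct)
  case (gen i)
  have "const ((mat 1 :: 'k ^ 'n ^ 'n) $ i $ j) * gen j = (if j = i then gen j else 0)" for j
    by (simp add: mat_def)
  then show ?case
    by (simp add: linear_subst_def)
qed (simp_all add: subst_add subst_mult)

text \<open>Without commutativity, the word \<open>js\<close> dictates which generator each linear
  factor contributes, so a single product of matrix entries survives.\<close>

lemma lookup_prod_linear_subst:
  "Poly_Mapping.lookup (prod_list (map (linear_subst M) is)) (Word js) =
    (if length is = length js then prod_list (map2 (\<lambda>i j. M $ i $ j) is js) else 0)"
proof (induction "is" arbitrary: js)
  case Nil
  then show ?case
    by (simp add: lookup_one zero_free_mon_def when_def)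
next
  case (Cons i "is")
  have "Poly_Mapping.lookup (linear_subst M i * p) (Word (j # js)) =
      M $ i $ j * Poly_Mapping.lookup p (Word js)"
    "Poly_Mapping.lookup (linear_subst M i * p) (Word []) = 0" for p j js
    by (simp_all add: linear_subst_def sum_distrib_right mult.assoc lookup_sum lookup_const_mult
        lookup_gen_mult if_distrib cong: if_cong)
  then show ?case
    by (cases js) (simp_all add: Cons)
qed

text \<open>In each degree a substitution acts on the coefficient tensor by the tensor power of
  \<open>M\<close>, contracted along row indices.\<close>

lemma lookup_subst:
  "Poly_Mapping.lookup (subst M p) (Word js) =
    (\<Sum>is | length is = length js.
      Poly_Mapping.lookup p (Word is) * prod_list (map2 (\<lambda>i j. M $ i $ j) is js))"
proof (induction p rule: poly_mapping_add_induct)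
  case (single u c)
  obtain v where u: "u = Word v"
    by (cases u)
  have "(\<Sum>is | length is = length js. Poly_Mapping.lookup (Poly_Mapping.single u c) (Word is) *
        prod_list (map2 (\<lambda>i j. M $ i $ j) is js)) =
      (\<Sum>is | length is = length js.
        if is = v then c * prod_list (map2 (\<lambda>i j. M $ i $ j) v js) else 0)"
    by (rule sum.cong) (auto simp: u lookup_single when_def)
  then show ?case
    by (simp add: u subst_single lookup_const_mult lookup_prod_linear_subst)
qed (simp add: subst_add lookup_add sum.distrib algebra_simps)

lemma subst_homogeneous:
  assumes "p \<in> homogeneous d"
  shows "subst M p \<in> homogeneous d"
proof -
  have "length js = d" if "Poly_Mapping.lookup (subst M p) (Word js) \<noteq> 0" for js
  proof -
    have "\<exists>is. length is = length js \<and> Poly_Mapping.lookup p (Word is) \<noteq> 0"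
      by (rule ccontr) (use that in \<open>auto simp: lookup_subst\<close>)
    then show ?thesis
      using assms unfolding homogeneous_def
      by (metis (mono_tags, lifting) free_mon.sel in_keys_iff mem_Collect_eq)
  qed
  then have "length (letters u) = d" if "Poly_Mapping.lookup (subst M p) u \<noteq> 0" for u
    using that by (metis free_mon.collapse)
  then show ?thesis
    by (simp add: homogeneous_def in_keys_iff)
qed

section \<open>Presented algebras\<close>

lemma ring_of_type_algebra_simps [simp]:
  "carrier (ring_of_type_algebra :: 'a::ring_1 ring) = UNIV"
  "x \<otimes>\<^bsub>(ring_of_type_algebra :: 'a ring)\<^esub> y = x * y"
  "x \<oplus>\<^bsub>(ring_of_type_algebra :: 'a ring)\<^esub> y = x + y"
  "\<one>\<^bsub>(ring_of_type_algebra :: 'a ring)\<^esub> = 1"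
  "\<zero>\<^bsub>(ring_of_type_algebra :: 'a ring)\<^esub> = 0"
  by (simp_all add: ring_of_type_algebra_def)

lemma ring_of_ring_1: "ring (ring_of_type_algebra :: 'a::ring_1 ring)"
proof -
  have "\<exists>y. x + y = 0 \<and> y + x = 0" for x :: 'a
    by (intro exI[of _ "- x"]) simp
  then show ?thesis
    unfolding ring_of_type_algebra_def
    by unfold_locales (auto simp: algebra_simps Units_def)
qed

lemma genideal_is_ideal: "ideal (genideal ring_of_type_algebra R) (ring_of_type_algebra :: 'a::ring_1 ring)"
  by (rule ring.genideal_ideal[OF ring_of_ring_1]) simp

lemma a_minus_ring_of_type_algebra [simp]:
  "\<ominus>\<^bsub>ring_of_type_algebra\<^esub> x = - (x :: 'a::ring_1)"
proof -
  interpret ring "ring_of_type_algebra :: 'a ring"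
    by (rule ring_of_ring_1)
  have "x \<oplus>\<^bsub>ring_of_type_algebra\<^esub> - x = \<zero>\<^bsub>ring_of_type_algebra\<^esub>"
    by simp
  then show ?thesis
    by (intro minus_equality) simp_all
qed

lemma idealI_ring_of_type_algebra:
  fixes S :: "'a::ring_1 set"
  assumes "0 \<in> S" "\<And>p q. p \<in> S \<Longrightarrow> q \<in> S \<Longrightarrow> p + q \<in> S"
    and mult: "\<And>a p. p \<in> S \<Longrightarrow> a * p \<in> S" "\<And>a p. p \<in> S \<Longrightarrow> p * a \<in> S"
  shows "ideal S ring_of_type_algebra"
proof (rule idealI[OF ring_of_ring_1])
  interpret ring "ring_of_type_algebra :: 'a ring"
    by (rule ring_of_ring_1)
  have "- p \<in> S" if "p \<in> S" for p
    using mult(1)[OF that, of "- 1"] by simp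
  then show "subgroup S (add_monoid (ring_of_type_algebra :: 'a ring))"
    using assms(1,2)
    by (intro add.subgroupI) (auto simp flip: a_inv_def)
qed (use mult in auto)

context
  fixes I :: "'a::ring_1 set"
  assumes ideal: "ideal I ring_of_type_algebra"
begin

interpretation ideal I ring_of_type_algebra
  by (rule ideal)

lemma ideal_zero: "0 \<in> I"
  using additive_subgroup.zero_closed[OF additive_subgroup_axioms] by simp

lemma ideal_add: "p \<in> I \<Longrightarrow> q \<in> I \<Longrightarrow> p + q \<in> I"
  using additive_subgroup.a_closed[OF additive_subgroup_axioms, of p q] by simp

lemma ideal_mult: "p \<in> I \<Longrightarrow> a * p \<in> I" "p \<in> I \<Longrightarrow> p * a \<in> I"
  using I_l_closed[of p a] I_r_closed[of p a] by simp_all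

lemma ideal_uminus: "p \<in> I \<Longrightarrow> - p \<in> I"
  using ideal_mult(1)[of p "- 1"] by simp

lemma ideal_sum: "(\<And>x. x \<in> A \<Longrightarrow> f x \<in> I) \<Longrightarrow> sum f A \<in> I"
  by (induction A rule: infinite_finite_induct) (auto intro: ideal_zero ideal_add)

lemma rcoset_eq_image: "I +>\<^bsub>ring_of_type_algebra\<^esub> p = (\<lambda>a. a + p) ` I"
  by (auto simp: a_r_coset_def')

lemma rcoset_eq_iff:
  "I +>\<^bsub>ring_of_type_algebra\<^esub> p = I +>\<^bsub>ring_of_type_algebra\<^esub> q \<longleftrightarrow> p - q \<in> I"
proof
  assume "I +>\<^bsub>ring_of_type_algebra\<^esub> p = I +>\<^bsub>ring_of_type_algebra\<^esub> q"
  then have "0 + p \<in> (\<lambda>a. a + q) ` I"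
    using ideal_zero by (auto simp: rcoset_eq_image)
  then show "p - q \<in> I"
    by auto
next
  assume pq: "p - q \<in> I"
  have "a + p \<in> (\<lambda>a. a + q) ` I" if "a \<in> I" for a
    using ideal_add[OF that pq] by (intro image_eqI[of _ _ "a + (p - q)"]) auto
  moreover have "a + q \<in> (\<lambda>a. a + p) ` I" if "a \<in> I" for a
    using ideal_add[OF that ideal_uminus[OF pq]] by (intro image_eqI[of _ _ "a + - (p - q)"]) auto
  ultimately show "I +>\<^bsub>ring_of_type_algebra\<^esub> p = I +>\<^bsub>ring_of_type_algebra\<^esub> q"
    by (auto simp: rcoset_eq_image)
qed

end

definition residue :: "'a::ring_1 set \<Rightarrow> 'a \<Rightarrow> 'a set" where
  "residue R p = genideal ring_of_type_algebra R +>\<^bsub>ring_of_type_algebra\<^esub> p"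

lemma residue_eq_iff: "residue R p = residue R q \<longleftrightarrow> p - q \<in> genideal ring_of_type_algebra R"
  unfolding residue_def by (rule rcoset_eq_iff[OF genideal_is_ideal])

text \<open>Rules for computing with representatives; later arguments use these instead of the
  quotient construction. The ring operations come from the coset map being a ring homomorphism, and
  the scalar rule is the product rule for a constant.\<close>

lemma presented_algebra_simps:
  "carrier (presented_algebra R) = range (residue R)"
  "residue R p \<otimes>\<^bsub>presented_algebra R\<^esub> residue R q = residue R (p * q)"
  "residue R p \<oplus>\<^bsub>presented_algebra R\<^esub> residue R q = residue R (p + q)"
  "\<one>\<^bsub>presented_algebra R\<^esub> = residue R 1"
  "c \<odot>\<^bsub>presented_algebra R\<^esub> residue R p = residue R (const c * p)"
  "component (presented_algebra R) d = residue R ` homogeneous d"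
proof -
  interpret ideal "genideal ring_of_type_algebra R" ring_of_type_algebra
    by (rule genideal_is_ideal)
  note quot = rcos_ring_hom[unfolded ring_hom_def]
  have mult: "residue R p \<otimes>\<^bsub>ring_of_type_algebra Quot genideal ring_of_type_algebra R\<^esub> residue R q =
      residue R (p * q)" for p q
    using quot by (auto simp: residue_def)
  show "residue R p \<otimes>\<^bsub>presented_algebra R\<^esub> residue R q = residue R (p * q)"
    using mult by (simp add: presented_algebra_def Let_def)
  show "residue R p \<oplus>\<^bsub>presented_algebra R\<^esub> residue R q = residue R (p + q)"
    using quot by (auto simp: residue_def presented_algebra_def Let_def)
  show "\<one>\<^bsub>presented_algebra R\<^esub> = residue R 1"
    using quot by (auto simp: residue_def presented_algebra_def Let_def)
  show "carrier (presented_algebra R) = range (residue R)"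
    by (auto simp: presented_algebra_def Let_def FactRing_def A_RCOSETS_def' residue_def)
  show "c \<odot>\<^bsub>presented_algebra R\<^esub> residue R p = residue R (const c * p)"
    using mult[of "const c" p] by (simp add: presented_algebra_def Let_def residue_def)
  show "component (presented_algebra R) d = residue R ` homogeneous d"
    by (simp add: presented_algebra_def Let_def residue_def[abs_def])
qed

section \<open>Graded isomorphisms and substitutions\<close>

lemma homogeneous_1_expansion:
  fixes q :: "('k::field, 'n::finite) free_alg"
  assumes "q \<in> homogeneous 1"
  shows "q = (\<Sum>j\<in>UNIV. const (Poly_Mapping.lookup q (Word [j])) * gen j)"
proof (rule poly_mapping_eqI)
  fix u
  have gen: "Poly_Mapping.lookup (gen j) u = (if u = Word [j] then 1 else 0)" for j :: 'n
    by (auto simp: gen_def lookup_single when_def)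
  show "Poly_Mapping.lookup q u =
      Poly_Mapping.lookup (\<Sum>j\<in>UNIV. const (Poly_Mapping.lookup q (Word [j])) * gen j) u"
  proof (cases "length (letters u) = 1")
    case True
    then obtain k where u: "u = Word [k]"
      by (cases u) (auto simp: length_Suc_conv)
    show ?thesis
      by (simp add: u lookup_sum lookup_const_mult gen[unfolded u] if_distrib cong: if_cong)
  next
    case False
    then have "Poly_Mapping.lookup q u = 0"
      using assms by (auto simp: homogeneous_def in_keys_iff)
    then show ?thesis
      using False by (auto simp: lookup_sum lookup_const_mult gen intro!: sum.neutral)
  qed
qed

text \<open>The grading makes the image of each generator the class of a linear form, and these
  linear forms are the rows of \<open>M\<close>. The isomorphism and \<open>subst M\<close> then
  agree modulo the ideal on generators, hence everywhere. Invertibility of \<open>M\<close> is not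
  asserted: with relations of degree one, the linear representatives are not unique.\<close>

lemma isomorphic_presented_algebrasD:
  fixes R R' :: "('k::field, 'n::finite) free_alg set"
  assumes "isomorphic_graded_algebras (presented_algebra R) (presented_algebra R')"
  obtains M :: "'k ^ 'n ^ 'n" where
    "\<And>p. p \<in> genideal ring_of_type_algebra R \<longleftrightarrow> subst M p \<in> genideal ring_of_type_algebra R'"
proof -
  obtain f where iso: "f \<in> ring_iso (presented_algebra R) (presented_algebra R')"
    and smult: "\<forall>c. \<forall>x\<in>carrier (presented_algebra R).
      f (c \<odot>\<^bsub>presented_algebra R\<^esub> x) = c \<odot>\<^bsub>presented_algebra R'\<^esub> f x"
    and comp: "\<forall>d. f ` component (presented_algebra R) d = component (presented_algebra R') d"
    using assms unfolding isomorphic_graded_algebras_def by (elim bexE conjE)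
  have residue_carrier: "residue R p \<in> carrier (presented_algebra R)" for p
    by (simp add: presented_algebra_simps)
  note hom = ring_iso_memE[OF iso]
  have f_smult: "f (residue R (const c * p)) = c \<odot>\<^bsub>presented_algebra R'\<^esub> f (residue R p)" for c p
    using smult[rule_format, OF residue_carrier, of c p] by (simp only: presented_algebra_simps)
  have f_mult: "f (residue R (p * q)) = f (residue R p) \<otimes>\<^bsub>presented_algebra R'\<^esub> f (residue R q)" for p q
    using hom(2)[OF residue_carrier residue_carrier, of p q] by (simp only: presented_algebra_simps)
  have f_add: "f (residue R (p + q)) = f (residue R p) \<oplus>\<^bsub>presented_algebra R'\<^esub> f (residue R q)" for p q
    using hom(3)[OF residue_carrier residue_carrier, of p q] by (simp only: presented_algebra_simps)
  have f_one: "f (residue R 1) = residue R' 1"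
    using hom(4) by (simp only: presented_algebra_simps)
  have f_comp: "f ` residue R ` homogeneous 1 = residue R' ` homogeneous 1"
    using comp by (simp only: presented_algebra_simps)
  have "\<exists>q. q \<in> homogeneous 1 \<and> f (residue R (gen i)) = residue R' q" for i
  proof -
    have "gen i \<in> (homogeneous 1 :: ('k, 'n) free_alg set)"
      by (simp add: homogeneous_def gen_def)
    then show ?thesis
      using f_comp by blast
  qed
  then obtain g where g: "\<And>i. g i \<in> homogeneous 1" "\<And>i. f (residue R (gen i)) = residue R' (g i)"
    by metis
  define M :: "'k ^ 'n ^ 'n" where "M = (\<chi> i j. Poly_Mapping.lookup (g i) (Word [j]))"
  have "g i = linear_subst M i" for i
    using homogeneous_1_expansion[OF g(1)[of i]] by (simp add: linear_subst_def M_def)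
  then have f: "f (residue R p) = residue R' (subst M p)" for p
  proof (induction p rule: free_alg_induct)
    case (const c)
    then show ?case
      using f_smult[of c 1] by (simp add: f_one presented_algebra_simps)
  qed (simp_all add: g f_add f_mult subst_add subst_mult presented_algebra_simps)
  have inj: "inj_on f (range (residue R))"
    using hom(5) by (simp only: bij_betw_def presented_algebra_simps)
  \<comment> \<open>Membership in an ideal is equality with the class of 0, so injectivity gives
    both implications.\<close>
  have "p \<in> genideal ring_of_type_algebra R \<longleftrightarrow> subst M p \<in> genideal ring_of_type_algebra R'" for p
    using inj_on_eq_iff[OF inj rangeI rangeI, of p 0] by (simp add: f residue_eq_iff)
  then show thesis
    by (rule that)
qed

text \<open>The preimage of an ideal under the ring homomorphism \<open>subst M\<close> is an ideal,
  and it contains the generators \<open>R\<close>.\<close>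

lemma subst_genideal:
  assumes "\<And>p. p \<in> R \<Longrightarrow> subst M p \<in> genideal ring_of_type_algebra R'"
    and "p \<in> genideal ring_of_type_algebra R"
  shows "subst M p \<in> genideal ring_of_type_algebra R'"
proof -
  let ?S = "subst M -` genideal ring_of_type_algebra R'"
  have "ideal ?S ring_of_type_algebra"
    by (rule idealI_ring_of_type_algebra)
      (auto simp: subst_add subst_mult intro: ideal_zero ideal_add ideal_mult genideal_is_ideal)
  then have "genideal ring_of_type_algebra R \<subseteq> ?S"
    using assms(1) by (intro ring.genideal_minimal[OF ring_of_ring_1]) auto
  then show ?thesis
    using assms(2) by auto
qed

text \<open>Residue classes are sets, so the isomorphism can be taken to be the image map of
  \<open>subst M\<close>. The conditions on \<open>M\<close> and on its inverse together make it
  carry one ideal onto the other, hence cosets onto cosets.\<close>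

lemma isomorphic_presented_algebrasI:
  fixes R R' :: "('k::field, 'n::finite) free_alg set"
  assumes inv: "M ** M' = mat 1" "M' ** M = mat 1"
    and R: "\<And>p. p \<in> R \<Longrightarrow> subst M p \<in> genideal ring_of_type_algebra R'"
    and R': "\<And>p. p \<in> R' \<Longrightarrow> subst M' p \<in> genideal ring_of_type_algebra R"
  shows "isomorphic_graded_algebras (presented_algebra R) (presented_algebra R')"
proof -
  let ?f = "(`) (subst M)"
  have cancel: "subst M (subst M' p) = p" "subst M' (subst M p) = p" for p
    by (simp_all add: subst_subst inv)
  have image: "?f (genideal ring_of_type_algebra R) = genideal ring_of_type_algebra R'"
  proof
    show "genideal ring_of_type_algebra R' \<subseteq> ?f (genideal ring_of_type_algebra R)"
      using subst_genideal[OF R'] cancel(1) by (metis image_eqI subsetI)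
  qed (use subst_genideal[OF R] in auto)
  have f: "?f (residue R p) = residue R' (subst M p)" for p
    unfolding residue_def rcoset_eq_image[OF genideal_is_ideal]
    by (simp add: image_image subst_add flip: image)
  have hom: "subst M ` homogeneous d = homogeneous d" for d
  proof
    show "homogeneous d \<subseteq> subst M ` homogeneous d"
      using subst_homogeneous[of _ d M'] cancel(1) by (metis image_eqI subsetI)
  qed (auto intro: subst_homogeneous)
  have "surj (subst M)"
    by (rule surjI) (rule cancel)
  then have range: "?f ` range (residue R) = range (residue R')"
    by (simp add: image_image f) (metis image_image)
  \<comment> \<open>An injective map has an injective image map on sets, so distinct cosets stay
    distinct.\<close>
  have "inj (subst M)"
    by (metis cancel(2) injI)
  then have "inj_on ?f (range (residue R))"
    by (auto simp: inj_on_def inj_image_eq_iff)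
  with range have "bij_betw ?f (range (residue R)) (range (residue R'))"
    by (simp add: bij_betw_def)
  then have "?f \<in> ring_iso (presented_algebra R) (presented_algebra R')"
    using subst_const[of M 1]
    by (intro ring_iso_memI; unfold presented_algebra_simps; (elim rangeE; hypsubst)?)
      (simp_all add: presented_algebra_simps f subst_add subst_mult)
  moreover have "?f ` component (presented_algebra R) d = component (presented_algebra R') d" for d
    using hom[of d] unfolding presented_algebra_simps by (simp add: image_image f) (metis image_image)
  ultimately show ?thesis
    unfolding isomorphic_graded_algebras_def
    by (intro bexI[of _ ?f]) (auto simp: presented_algebra_simps f subst_mult)
qed

section \<open>The ideal of relations up to degree \<open>N\<close>\<close>

text \<open>Multiplying a relation by a word of positive length pushes it above degree
  \<open>N\<close>, so only linear combinations of the \<open>r i\<close> remain in degree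
  \<open>N\<close>. The second claim describes the degree-\<open>N\<close> part of \<open>p\<close>,
  which need not be homogeneous.\<close>

lemma genideal_low_degree:
  fixes r :: "'n::finite \<Rightarrow> ('k::field, 'n) free_alg"
  assumes "p \<in> genideal ring_of_type_algebra (range r)" and r: "\<And>i. r i \<in> homogeneous N"
  shows "length (letters u) < N \<Longrightarrow> Poly_Mapping.lookup p u = 0"
    and "\<exists>k. \<forall>u. length (letters u) = N \<longrightarrow>
      Poly_Mapping.lookup p u = (\<Sum>i\<in>UNIV. k i * Poly_Mapping.lookup (r i) u)"
proof -
  define low :: "('k, 'n) free_alg \<Rightarrow> bool"
    where "low p \<longleftrightarrow> (\<forall>u. length (letters u) < N \<longrightarrow> Poly_Mapping.lookup p u = 0)" for p
  define comb where "comb k p \<longleftrightarrow> (\<forall>u. length (letters u) = N \<longrightarrow>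
      Poly_Mapping.lookup p u = (\<Sum>i\<in>UNIV. k i * Poly_Mapping.lookup (r i) u))" for k p
  \<comment> \<open>An ideal: up to degree \<open>N\<close>, multiplying a \<open>low\<close> element by \<open>a\<close> only scales it by the constant
    term of \<open>a\<close>.\<close>
  define S where "S = {p. low p \<and> (\<exists>k. comb k p)}"
  have low_mult: "Poly_Mapping.lookup (a * p) u = Poly_Mapping.lookup a 0 * Poly_Mapping.lookup p u"
      "Poly_Mapping.lookup (p * a) u = Poly_Mapping.lookup a 0 * Poly_Mapping.lookup p u"
    if "low p" "length (letters u) \<le> N" for a p u
    using that lookup_mult_low[of u p a] by (auto simp: low_def)
  have "ideal S ring_of_type_algebra"
  proof (rule idealI_ring_of_type_algebra)
    have "comb (\<lambda>_. 0) 0"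
      by (simp add: comb_def)
    then show "0 \<in> S"
      by (auto simp: S_def low_def)
  next
    fix p q assume pq: "p \<in> S" "q \<in> S"
    then obtain k l where "comb k p" "comb l q"
      by (auto simp: S_def)
    then have "comb (\<lambda>i. k i + l i) (p + q)"
      by (simp add: comb_def lookup_add sum.distrib algebra_simps)
    then show "p + q \<in> S"
      using pq by (auto simp: S_def low_def lookup_add)
  next
    fix a p assume "p \<in> S"
    then obtain k where p: "low p" "comb k p"
      by (auto simp: S_def)
    then have "comb (\<lambda>i. Poly_Mapping.lookup a 0 * k i) (a * p)"
        "comb (\<lambda>i. Poly_Mapping.lookup a 0 * k i) (p * a)"
      by (simp_all add: comb_def low_mult sum_distrib_left mult.assoc)
    moreover have "low (a * p)" "low (p * a)"
      using p(1) low_mult[OF p(1)] by (simp_all add: low_def)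
    ultimately show "a * p \<in> S" "p * a \<in> S"
      by (auto simp: S_def)
  qed
  moreover have "r i \<in> S" for i
  proof -
    have "comb (\<lambda>j. if j = i then 1 else 0) (r i)"
      by (simp add: comb_def if_distrib[of "\<lambda>x. x * _"] cong: if_cong)
    moreover have "low (r i)"
      using r[of i] by (auto simp: low_def homogeneous_def in_keys_iff)
    ultimately show ?thesis
      by (auto simp: S_def)
  qed
  ultimately have "genideal ring_of_type_algebra (range r) \<subseteq> S"
    by (intro ring.genideal_minimal[OF ring_of_ring_1]) auto
  with assms(1) show "length (letters u) < N \<Longrightarrow> Poly_Mapping.lookup p u = 0"
    "\<exists>k. \<forall>u. length (letters u) = N \<longrightarrow>
      Poly_Mapping.lookup p u = (\<Sum>i\<in>UNIV. k i * Poly_Mapping.lookup (r i) u)"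
    by (auto simp: S_def low_def comb_def)
qed

section \<open>Algebras of multilinear forms\<close>

lemma matrix_vector_mult_axis: "(M *v axis j 1) $ i = (M :: 'a::semiring_1 ^ 'n ^ 'm) $ i $ j"
  by (simp add: matrix_vector_mult_def axis_def if_distrib cong: if_cong)

lemma form_relation_homogeneous: "form_relation w N i \<in> homogeneous N"
  and lookup_form_relation:
  "Poly_Mapping.lookup (form_relation w N i) (Word js) =
    (if length js = N then form_coeff w (i # js) else 0)"
proof -
  have *: "Poly_Mapping.lookup (form_relation w N i) (Word js) =
    (if length js = N then form_coeff w (i # js) else 0)" for js
    by (simp add: form_relation_def lookup_sum lookup_const_mult prod_list_gen lookup_single when_def
        if_distrib cong: if_cong)
  then show "Poly_Mapping.lookup (form_relation w N i) (Word js) =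
    (if length js = N then form_coeff w (i # js) else 0)" .
  have "length (letters u) = N" if "Poly_Mapping.lookup (form_relation w N i) u \<noteq> 0" for u
    using that *[of "letters u"] by (auto split: if_splits)
  then show "form_relation w N i \<in> homogeneous N"
    by (auto simp: homogeneous_def in_keys_iff)
qed

text \<open>The tensor formula for \<open>subst\<close> is the multilinear expansion of
  \<open>w\<close> in its last \<open>N\<close> arguments. The first argument labels the relation
  and is not transformed.\<close>

lemma lookup_subst_form_relation:
  fixes w :: "('k::field ^ 'n) list \<Rightarrow> 'k"
  assumes "multilinear_form (Suc N) w"
  shows "Poly_Mapping.lookup (subst M (form_relation w N i)) (Word js) =
    (if length js = N then w (axis i 1 # map (\<lambda>j. M *v axis j 1) js) else 0)"
proof (cases "length js = N")
  case True
  \<comment> \<open>The vector \<open>M *v axis j 1\<close> is column \<open>j\<close> of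
    \<open>M\<close>, whose entries are those appearing in \<open>lookup_subst\<close>.\<close>
  have "map2 ($) (map (\<lambda>j. M *v axis j 1) js) is = map2 (\<lambda>i j. M $ i $ j) is js" for "is"
    by (auto simp: zip_map1 matrix_vector_mult_axis zip_commute[of js] split_def)
  then show ?thesis
    using multilinear_form_expansion[OF multilinear_form_Cons[OF assms],
        of "map (\<lambda>j. M *v axis j 1) js"] True
    by (simp add: lookup_subst lookup_form_relation form_coeff_def mult.commute)
next
  case False
  then show ?thesis
    by (simp add: lookup_subst lookup_form_relation)
qed

text \<open>Substitution moves all arguments but the first. Writing \<open>axis i 1\<close> as
  \<open>L\<close> applied to \<open>L' *v axis i 1\<close> lets the hypothesis on \<open>w'\<close>
  apply to all \<open>N + 1\<close> arguments; the image is then a combination of the relations of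
  \<open>w'\<close> with coefficients from column \<open>i\<close> of \<open>L'\<close>.\<close>

lemma subst_form_relation_in_ideal:
  fixes w w' :: "('k::field ^ 'n) list \<Rightarrow> 'k"
  assumes w: "multilinear_form (Suc N) w" and w': "multilinear_form (Suc N) w'"
    and comp: "\<And>xs. length xs = Suc N \<Longrightarrow> w' xs = w (map ((*v) L) xs)"
    and inv: "L ** L' = mat 1"
  shows "subst L (form_relation w N i) \<in> genideal ring_of_type_algebra (range (form_relation w' N))"
proof -
  have "w (axis i 1 # map (\<lambda>j. L *v axis j 1) js) =
      (\<Sum>k\<in>UNIV. L' $ k $ i * form_coeff w' (k # js))" if "length js = N" for js
  proof -
    let ?xs = "map (\<lambda>j. axis j 1) js :: ('k ^ 'n) list"
    have "L *v (L' *v axis i 1) = axis i 1"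
      by (simp add: matrix_vector_mul_assoc inv)
    then have "w (axis i 1 # map (\<lambda>j. L *v axis j 1) js) = w' (L' *v axis i 1 # ?xs)"
      using comp[of "L' *v axis i 1 # ?xs"] that by (simp add: comp_def)
    also have "\<dots> = (\<Sum>k\<in>UNIV. (L' *v axis i 1) $ k * w' (axis k 1 # ?xs))"
      by (rule linear_functional_expansion, rule multilinear_form_linear_hd[OF w']) (simp add: that)
    finally show ?thesis
      by (simp add: matrix_vector_mult_axis form_coeff_def)
  qed
  then have "Poly_Mapping.lookup (subst L (form_relation w N i)) u =
      Poly_Mapping.lookup (\<Sum>k\<in>UNIV. const (L' $ k $ i) * form_relation w' N k) u" for u
    by (cases u) (simp add: lookup_subst_form_relation[OF w] lookup_sum lookup_const_mult
        lookup_form_relation)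
  then have "subst L (form_relation w N i) = (\<Sum>k\<in>UNIV. const (L' $ k $ i) * form_relation w' N k)"
    by (rule poly_mapping_eqI)
  moreover have "form_relation w' N k \<in> genideal ring_of_type_algebra (range (form_relation w' N))" for k
    using ring.genideal_self[OF ring_of_ring_1, of "range (form_relation w' N)"] by auto
  ultimately show ?thesis
    by (auto intro: ideal_sum ideal_mult genideal_is_ideal)
qed

text \<open>The inverse of \<open>L\<close> recovers \<open>w\<close> from \<open>w'\<close>, so the
  preceding inclusion of relations holds in both directions.\<close>

lemma isomorphic_form_algebras_form_comp:
  fixes w w' :: "('k::field ^ 'n) list \<Rightarrow> 'k"
  assumes w: "multilinear_form (Suc N) w" and w': "multilinear_form (Suc N) w'"
    and "invertible L" and comp: "\<And>xs. length xs = Suc N \<Longrightarrow> w' xs = form_comp w L xs"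
  shows "isomorphic_graded_algebras (form_algebra w N) (form_algebra w' N)"
proof -
  obtain L' where inv: "L ** L' = mat 1" "L' ** L = mat 1"
    using \<open>invertible L\<close> by (auto simp: invertible_def)
  have comp': "w xs = w' (map ((*v) L') xs)" if "length xs = Suc N" for xs
    using that by (simp add: comp form_comp_def comp_def matrix_vector_mul_assoc inv)
  show ?thesis
    unfolding form_algebra_def
  proof (rule isomorphic_presented_algebrasI[OF inv])
    show "subst L p \<in> genideal ring_of_type_algebra (range (form_relation w' N))"
      if "p \<in> range (form_relation w N)" for p
      using that subst_form_relation_in_ideal[OF w w' _ inv(1)] comp by (auto simp: form_comp_def)
    show "subst L' p \<in> genideal ring_of_type_algebra (range (form_relation w N))"
      if "p \<in> range (form_relation w' N)" for p
      using that subst_form_relation_in_ideal[OF w' w comp' inv(2)] by auto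
  qed
qed

section \<open>From an isomorphism to an equality of forms\<close>

text \<open>Two degrees of the ideal are examined. Degree one, where the ideal vanishes, gives
  invertibility of \<open>L\<close>; degree \<open>N\<close> gives \<open>K\<close>, which records
  how substituted relations of \<open>w\<close> combine those of \<open>w'\<close>.\<close>

lemma isomorphic_form_algebrasD:
  fixes w w' :: "('k::field ^ 'n) list \<Rightarrow> 'k"
  assumes w: "multilinear_form (Suc N) w" and w': "multilinear_form (Suc N) w'" and "2 \<le> N"
    and iso: "isomorphic_graded_algebras (form_algebra w N) (form_algebra w' N)"
  obtains L K :: "'k ^ 'n ^ 'n" where "invertible L"
    and "\<And>x xs. length xs = N \<Longrightarrow> w (x # map ((*v) L) xs) = w' (K *v x # xs)"
proof -
  obtain L :: "'k ^ 'n ^ 'n" where L: "\<And>p. p \<in> genideal ring_of_type_algebra (range (form_relation w N)) \<longleftrightarrow>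
      subst L p \<in> genideal ring_of_type_algebra (range (form_relation w' N))"
    using isomorphic_presented_algebrasD iso unfolding form_algebra_def by blast
  \<comment> \<open>Such a \<open>v\<close> is the coefficient vector of a linear form
    \<open>p\<close> annihilated by the substitution. Then \<open>p\<close> lies in the ideal of
    \<open>w\<close>, which has nothing in degree one because \<open>N\<close> is at least
    2.\<close>
  have "v = 0" if v: "transpose L *v v = 0" for v
  proof -
    define p where "p = (\<Sum>i\<in>UNIV. const (v $ i) * gen i)"
    have "(\<Sum>i\<in>UNIV. v $ i * L $ i $ j) = 0" for j
      using v by (simp add: matrix_vector_mult_def transpose_def vec_eq_iff mult.commute)
    moreover have "subst L p = (\<Sum>j\<in>UNIV. const (\<Sum>i\<in>UNIV. v $ i * L $ i $ j) * gen j)"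
      unfolding p_def subst_sum subst_mult subst_const subst_gen linear_subst_def const_sum const_mult
        sum_distrib_left sum_distrib_right mult.assoc
      by (rule sum.swap)
    ultimately have "subst L p = 0"
      by simp
    then have "p \<in> genideal ring_of_type_algebra (range (form_relation w N))"
      by (simp add: L ideal_zero genideal_is_ideal)
    then have "Poly_Mapping.lookup p (Word [i]) = 0" for i
      by (rule genideal_low_degree(1)[OF _ form_relation_homogeneous]) (use \<open>2 \<le> N\<close> in simp)
    moreover have "Poly_Mapping.lookup p (Word [i]) = v $ i" for i
      by (simp add: p_def lookup_sum lookup_const_mult gen_def lookup_single when_def if_distrib
          cong: if_cong)
    ultimately show ?thesis
      by (simp add: vec_eq_iff)
  qed
  then obtain B where "B ** transpose L = mat 1"
    using matrix_left_invertible_ker by blast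
  then have "L ** transpose B = mat 1"
    by (metis matrix_transpose_mul transpose_mat transpose_transpose)
  then have "invertible L"
    by (auto simp: invertible_right_inverse)
  have "\<exists>k. \<forall>js. length js = N \<longrightarrow>
      w (axis i 1 # map (\<lambda>j. L *v axis j 1) js) = (\<Sum>l\<in>UNIV. k l * form_coeff w' (l # js))" for i
  proof -
    have "form_relation w N i \<in> genideal ring_of_type_algebra (range (form_relation w N))"
      using ring.genideal_self[OF ring_of_ring_1, of "range (form_relation w N)"] by auto
    from genideal_low_degree(2)[OF L[THEN iffD1, OF this] form_relation_homogeneous]
    obtain k where "\<forall>u. length (letters u) = N \<longrightarrow>
        Poly_Mapping.lookup (subst L (form_relation w N i)) u =
        (\<Sum>l\<in>UNIV. k l * Poly_Mapping.lookup (form_relation w' N l) u)"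
      by blast
    then have "\<forall>js. length js = N \<longrightarrow>
        Poly_Mapping.lookup (subst L (form_relation w N i)) (Word js) =
        (\<Sum>l\<in>UNIV. k l * Poly_Mapping.lookup (form_relation w' N l) (Word js))"
      by simp
    then show ?thesis
      by (auto simp: lookup_subst_form_relation[OF w] lookup_form_relation)
  qed
  then obtain k where k: "\<And>i js. length js = N \<Longrightarrow>
      w (axis i 1 # map (\<lambda>j. L *v axis j 1) js) = (\<Sum>l\<in>UNIV. k i l * form_coeff w' (l # js))"
    by metis
  \<comment> \<open>The indices are exchanged so that the coefficients for relation \<open>i\<close>
    form column \<open>i\<close>, that is, \<open>K *v axis i 1\<close>.\<close>
  define K :: "'k ^ 'n ^ 'n" where "K = (\<chi> l i. k i l)"
  have basis: "w (axis i 1 # map ((*v) L) xs) = w' (K *v axis i 1 # xs)" if "length xs = N" for i xs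
  proof -
    have "form_comp (\<lambda>xs. w (axis i 1 # xs)) L xs = w' (K *v axis i 1 # xs)"
    proof (rule multilinear_form_eqI[OF multilinear_form_form_comp[OF multilinear_form_Cons[OF w]]
          multilinear_form_Cons[OF w'] that])
      fix js :: "'n list" assume len: "length js = N"
      let ?xs = "map (\<lambda>j. axis j 1) js :: ('k ^ 'n) list"
      have "w' (K *v axis i 1 # ?xs) = (\<Sum>l\<in>UNIV. (K *v axis i 1) $ l * w' (axis l 1 # ?xs))"
        by (rule linear_functional_expansion, rule multilinear_form_linear_hd[OF w']) (simp add: len)
      then show "form_coeff (form_comp (\<lambda>xs. w (axis i 1 # xs)) L) js =
          form_coeff (\<lambda>xs. w' (K *v axis i 1 # xs)) js"
        by (simp add: form_coeff_def form_comp_def comp_def k[OF len] K_def matrix_vector_mult_axis)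
    qed
    then show ?thesis
      by (simp add: form_comp_def)
  qed
  have "w (x # map ((*v) L) xs) = w' (K *v x # xs)" if len: "length xs = N" for x xs
  proof -
    have "Vector_Spaces.linear (*s) (*) (\<lambda>x. w' (K *v x # xs))"
      using Vector_Spaces.linear_compose[OF matrix_vector_mul_linear_gen
          multilinear_form_linear_hd[OF w' len], of K] by (simp add: comp_def)
    from linear_functional_expansion[OF this, of x]
    show ?thesis
      using linear_functional_expansion[OF multilinear_form_linear_hd[OF w, of "map ((*v) L) xs"], of x]
        len by (simp add: basis)
  qed
  with \<open>invertible L\<close> show thesis
    by (rule that)
qed

text \<open>The form \<open>w \<circ> L\<close> is twisted cyclic with twist \<open>L' Q L\<close>,
  where \<open>L'\<close> inverts \<open>L\<close>, and it equals \<open>w'\<close> with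
  \<open>P\<close> inserted in the first slot. Rotating by one place on both sides therefore carries
  \<open>P\<close> into the second slot of \<open>w'\<close>.\<close>

lemma three_regular_twist_scalar:
  fixes w w' :: "('k::field ^ 'n) list \<Rightarrow> 'k"
  assumes w: "preregular (Suc N) w" and w': "three_regular N w'" and "2 \<le> N" and L: "invertible L"
    and twist: "\<And>x xs. length xs = N \<Longrightarrow> w (map ((*v) L) (x # xs)) = w' (P *v x # xs)"
  obtains c where "c \<noteq> 0" "\<And>xs. length xs = Suc N \<Longrightarrow> form_comp w L xs = c * w' xs"
proof -
  have w'_pre: "preregular (Suc N) w'"
    using w' by (simp add: three_regular_def)
  obtain Q where Q: "Vector_Spaces.linear (*s) (*s) Q"
      "\<And>xs x. length xs = N \<Longrightarrow> w (xs @ [x]) = w (Q x # xs)"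
    using w by (auto simp: preregular_def)
  obtain Q' where Q': "Vector_Spaces.linear (*s) (*s) Q'" "bij Q'"
      "\<And>xs x. length xs = N \<Longrightarrow> w' (xs @ [x]) = w' (Q' x # xs)"
    using w'_pre by (auto simp: preregular_def)
  obtain R where R: "Vector_Spaces.linear (*s) (*s) R" "R \<circ> Q' = id"
    using vec.linear_injective_left_inverse[OF Q'(1)] Q'(2) by (auto simp: bij_def)
  have Q'R: "Q' (R x) = x" for x
  proof -
    obtain y where "x = Q' y"
      using surjD[OF bij_is_surj[OF Q'(2)]] by blast
    then show ?thesis
      using fun_cong[OF R(2), of y] by simp
  qed
  obtain L' where inv: "L ** L' = mat 1"
    using L by (auto simp: invertible_def)
  \<comment> \<open>Read from the right: \<open>R\<close> undoes the twist of \<open>w'\<close>,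
    \<open>L' Q L\<close> is the twist of \<open>w \<circ> L\<close>, and \<open>P\<close> returns
    from \<open>w \<circ> L\<close> to \<open>w'\<close>.\<close>
  define T where "T = (\<lambda>x. P *v (L' *v Q (L *v R x)))"
  have "Vector_Spaces.linear (*s) (*s) T"
    using Vector_Spaces.linear_compose[OF R(1) Vector_Spaces.linear_compose[OF
        matrix_vector_mul_linear_gen[of L] Vector_Spaces.linear_compose[OF Q(1)
        matrix_vector_mul_linear_gen[of "P ** L'"]]]]
    by (simp add: T_def comp_def matrix_vector_mul_assoc)
  moreover have "w' (T x0 # x1 # xs) = w' (x0 # (P *v x1) # xs)" if len: "length xs = N - 1" for x0 x1 xs
  proof -
    have "w' (T x0 # x1 # xs) = w (map ((*v) L) ((L' *v Q (L *v R x0)) # x1 # xs))"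
      using len \<open>2 \<le> N\<close> by (subst twist) (auto simp: T_def)
    \<comment> \<open>Now the head has the form \<open>Q y\<close>, so cyclicity of \<open>w\<close>
      sends \<open>y\<close> to the end. This exposes \<open>x1\<close> as the new first argument,
      where \<open>twist\<close> inserts \<open>P\<close>.\<close>
    also have "\<dots> = w (Q (L *v R x0) # map ((*v) L) (x1 # xs))"
      by (simp add: matrix_vector_mul_assoc inv)
    also have "\<dots> = w (map ((*v) L) (x1 # xs) @ [L *v R x0])"
      using len \<open>2 \<le> N\<close> by (subst Q(2)) auto
    also have "\<dots> = w (map ((*v) L) (x1 # xs @ [R x0]))"
      by simp
    also have "\<dots> = w' (((P *v x1) # xs) @ [R x0])"
      using len \<open>2 \<le> N\<close> by (subst twist) auto
    also have "\<dots> = w' (x0 # (P *v x1) # xs)"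
      using len \<open>2 \<le> N\<close> by (subst Q'(3)) (auto simp: Q'R)
    finally show ?thesis .
  qed
  ultimately have "\<exists>c. T = (\<lambda>x. c *s x) \<and> (*v) P = (\<lambda>x. c *s x)"
    using w' matrix_vector_mul_linear_gen[of P] unfolding three_regular_def by blast
  then obtain c where c: "\<And>x. P *v x = c *s x"
    by metis
  have ml: "multilinear_form (Suc N) w'"
    using w'_pre by (simp add: preregular_def)
  have comp: "form_comp w L (x # xs) = c * w' (x # xs)" if "length xs = N" for x xs
    using twist[OF that] multilinear_form_linear_hd[OF ml that]
    by (simp add: form_comp_def c Vector_Spaces.linear_iff)
  \<comment> \<open>With \<open>c = 0\<close> the form \<open>w \<circ> L\<close> would vanish;
    since \<open>L\<close> is onto, so would \<open>w\<close>, and non-degeneracy would make every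
    vector zero, including a basis vector.\<close>
  have "c \<noteq> 0"
  proof
    assume "c = 0"
    have "x = 0" for x :: "'k ^ 'n"
    proof -
      have "w (x # ys) = 0" if "length ys = N" for ys
        using comp[of "map ((*v) L') ys" "L' *v x"] that \<open>c = 0\<close>
        by (simp add: form_comp_def comp_def matrix_vector_mul_assoc inv)
      then show "x = 0"
        using w by (simp add: preregular_def)
    qed
    then have "axis undefined 1 = (0 :: 'k ^ 'n)"
      by blast
    then show False
      by (simp add: axis_eq_0_iff)
  qed
  moreover have "form_comp w L xs = c * w' xs" if "length xs = Suc N" for xs
    using that comp by (auto simp: length_Suc_conv)
  ultimately show thesis
    by (rule that)
qed

theorem proposition6:
  fixes w w' :: "('k::{alg_closed_field, field_char_0} ^ 'n) list \<Rightarrow> 'k"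
    and N s :: nat
  assumes "N \<ge> 2" and "s \<ge> 1" and "CARD('n) = s + 1"
    and "three_regular N w" and "three_regular N w'"
  shows "isomorphic_graded_algebras (form_algebra w N) (form_algebra w' N) \<longleftrightarrow>
    (\<exists>L :: 'k ^ 'n ^ 'n. invertible L \<and>
      (\<forall>xs. length xs = N + 1 \<longrightarrow> w' xs = form_comp w L xs))"
proof -
  have pre: "preregular (Suc N) w"
    using assms(4) by (simp add: three_regular_def)
  then have w: "multilinear_form (Suc N) w"
    by (simp add: preregular_def)
  have w': "multilinear_form (Suc N) w'"
    using assms(5) by (simp add: three_regular_def preregular_def)
  show ?thesis
  proof
    assume "isomorphic_graded_algebras (form_algebra w N) (form_algebra w' N)"
    then obtain L K :: "'k ^ 'n ^ 'n" where L: "invertible L"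
      and K: "\<And>x xs. length xs = N \<Longrightarrow> w (x # map ((*v) L) xs) = w' (K *v x # xs)"
      using isomorphic_form_algebrasD[OF w w' assms(1)] by blast
    \<comment> \<open>Taking \<open>L *v x\<close> as first argument turns the left side into
      \<open>w \<circ> L\<close>, so the twist becomes \<open>K ** L\<close>.\<close>
    have "w (map ((*v) L) (x # xs)) = w' ((K ** L) *v x # xs)" if "length xs = N" for x xs
      using K[OF that, of "L *v x"] by (simp add: matrix_vector_mul_assoc)
    then obtain c where c: "c \<noteq> 0" "\<And>xs. length xs = Suc N \<Longrightarrow> form_comp w L xs = c * w' xs"
      using three_regular_twist_scalar[OF pre assms(5,1) L] by blast
    \<comment> \<open>Scaling all \<open>N + 1\<close> arguments by \<open>d\<close> multiplies the
      form by the \<open>(N + 1)\<close>-st power of \<open>d\<close>, which must cancel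
      \<open>c\<close>. Algebraic closedness provides the root.\<close>
    obtain d where d: "d ^ Suc N = inverse c"
      using nth_root_exists[of "Suc N" "inverse c"] by auto
    with c(1) have "d \<noteq> 0"
      by auto
    have scale: "mat d *v x = d *s x" for x :: "'k ^ 'n"
      by (simp add: mat_def matrix_vector_mult_def vec_eq_iff if_distrib[of "\<lambda>x. x * _"] cong: if_cong)
    have "mat (inverse d) ** mat d = (mat 1 :: 'k ^ 'n ^ 'n)"
      using \<open>d \<noteq> 0\<close> by (simp add: matrix_matrix_mult_def mat_def vec_eq_iff
          if_distrib[of "\<lambda>x. x * _"] cong: if_cong)
    then have "invertible (mat d ** L)"
      by (intro invertible_mult L) (auto simp: invertible_left_inverse)
    moreover have "w' xs = form_comp w (mat d ** L) xs" if "length xs = N + 1" for xs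
    proof -
      have "(*v) (mat d ** L) = (*s) d \<circ> (*v) L"
        by (simp add: fun_eq_iff scale flip: matrix_vector_mul_assoc)
      then have "form_comp w (mat d ** L) xs = w (map ((*s) d) (map ((*v) L) xs))"
        by (simp add: form_comp_def)
      also have "\<dots> = d ^ Suc N * form_comp w L xs"
        using multilinear_form_scale[OF w, of "map ((*v) L) xs" d] that by (simp add: form_comp_def)
      also have "\<dots> = w' xs"
        using c that by (simp add: d del: power_Suc)
      finally show ?thesis ..
    qed
    ultimately show "\<exists>L :: 'k ^ 'n ^ 'n. invertible L \<and>
        (\<forall>xs. length xs = N + 1 \<longrightarrow> w' xs = form_comp w L xs)"
      by blast
  next
    assume "\<exists>L :: 'k ^ 'n ^ 'n. invertible L \<and>
        (\<forall>xs. length xs = N + 1 \<longrightarrow> w' xs = form_comp w L xs)"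
    then show "isomorphic_graded_algebras (form_algebra w N) (form_algebra w' N)"
      using isomorphic_form_algebras_form_comp[OF w w'] by auto
  qed
qed

end
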